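(* Let $R$ be a ring, let $M$ be a right $R$-module, let $\mathcal{X}=\{X_i\}_{i\in I}$ be a nonempty collection of pairwise comaximal ideals of $R$, and let $Y$ be a generating set for $M$. Then: (1) for each $y\in Y$ there exists a finite subset $J\subseteq I$ such that $\bigcap_{j\in J}X_j\subseteq\underline{r}_R(y)$ if and only if $M=\bigoplus_{i\in I}\underline{\ell}_M(X_i)$; (2) for each $y\in Y$ there exist a finite subset $J\subseteq I$ and positive integers $k_j$, $j\in J$, such that $\bigcap_{j\in J}X_j^{k_j}\subseteq\underline{r}_R(y)$ if and only if $M=\bigoplus_{i\in I}C(X_i)$. (In each of (1) and (2) the left-hand condition of the equivalence is the whole statement "for each $y\in Y$ there exist ...".)
   Context: Rings are associative with identity, not necessarily commutative; modules are unital right modules; ideals are two-sided. A nonempty family $\{X_i\}_{i\in I}$ of ideals of $R$ is pairwise comaximal if $X_i+X_j=R$ for all $i\neq j$ in $I$. For $X\subseteq R$, $\underline{\ell}_M(X)=\{m\in M\mid mx=0\text{ for all }x\in X\}$. For an element $y\in M$, $\underline{r}_R(y)=\{r\in R\mid yr=0\}$. For an ideal $X$ of $R$, the component of $X$ in $M$ is $C(X)=\sum_{k\ge 1}\underline{\ell}_M(X^k)$. The notation $M=\bigoplus_{i}N_i$ for submodules $N_i\le M$ means that $M$ is their internal direct sum. An empty intersection of ideals of $R$ is $R$. *)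

theory Defs
  imports "HOL-Algebra.Ideal_Product" "HOL-Algebra.Module"
begin

text \<open>
  The library's \<^locale>\<open>module\<close> requires a commutative ring of scalars, so right modules over an
  arbitrary ring are set up here. As for the library's module record, the multiplicative fields
  inherited from the ring record are unused.
\<close>

record ('r, 'm) rmodule = "'m ring" +
  ract :: "'m \<Rightarrow> 'r \<Rightarrow> 'm" (infixl \<open>\<star>\<index>\<close> 70)

locale right_module = R?: ring R + M?: abelian_group M
  for R :: "('r, 'a) ring_scheme" (structure)
    and M :: "('r, 'm, 'b) rmodule_scheme" (structure) +
  assumes ract_closed [simp, intro]:
      "\<lbrakk>x \<in> carrier M; a \<in> carrier R\<rbrakk> \<Longrightarrow> x \<star>\<^bsub>M\<^esub> a \<in> carrier M"
    and ract_distr_add: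
      "\<lbrakk>x \<in> carrier M; y \<in> carrier M; a \<in> carrier R\<rbrakk>
        \<Longrightarrow> (x \<oplus>\<^bsub>M\<^esub> y) \<star>\<^bsub>M\<^esub> a = x \<star>\<^bsub>M\<^esub> a \<oplus>\<^bsub>M\<^esub> y \<star>\<^bsub>M\<^esub> a"
    and ract_distr_scalar:
      "\<lbrakk>x \<in> carrier M; a \<in> carrier R; b \<in> carrier R\<rbrakk>
        \<Longrightarrow> x \<star>\<^bsub>M\<^esub> (a \<oplus>\<^bsub>R\<^esub> b) = x \<star>\<^bsub>M\<^esub> a \<oplus>\<^bsub>M\<^esub> x \<star>\<^bsub>M\<^esub> b"
    and ract_assoc:
      "\<lbrakk>x \<in> carrier M; a \<in> carrier R; b \<in> carrier R\<rbrakk>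
        \<Longrightarrow> x \<star>\<^bsub>M\<^esub> (a \<otimes>\<^bsub>R\<^esub> b) = (x \<star>\<^bsub>M\<^esub> a) \<star>\<^bsub>M\<^esub> b"
    and ract_one [simp]:
      "x \<in> carrier M \<Longrightarrow> x \<star>\<^bsub>M\<^esub> \<one>\<^bsub>R\<^esub> = x"

definition right_submodule ::
    "('r, 'a) ring_scheme \<Rightarrow> ('r, 'm, 'b) rmodule_scheme \<Rightarrow> 'm set \<Rightarrow> bool" where
  "right_submodule R M N \<longleftrightarrow>
     subgroup N (add_monoid M) \<and> (\<forall>x\<in>N. \<forall>a\<in>carrier R. x \<star>\<^bsub>M\<^esub> a \<in> N)"

definition generates ::
    "('r, 'a) ring_scheme \<Rightarrow> ('r, 'm, 'b) rmodule_scheme \<Rightarrow> 'm set \<Rightarrow> bool" where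
  "generates R M Y \<longleftrightarrow>
     Y \<subseteq> carrier M \<and> \<Inter>{N. right_submodule R M N \<and> Y \<subseteq> N} = carrier M"

text \<open>The sum of a possibly infinite family of submodules: all finite sums of their elements.\<close>

definition submodule_sum ::
    "('r, 'm, 'b) rmodule_scheme \<Rightarrow> 'i set \<Rightarrow> ('i \<Rightarrow> 'm set) \<Rightarrow> 'm set" where
  "submodule_sum M I N =
     {finsum M f F |f F. finite F \<and> F \<subseteq> I \<and> (\<forall>i\<in>F. f i \<in> N i)}"

definition internal_direct_sum ::
    "('r, 'a) ring_scheme \<Rightarrow> ('r, 'm, 'b) rmodule_scheme \<Rightarrow> 'i set \<Rightarrow> ('i \<Rightarrow> 'm set) \<Rightarrow> bool" where
  "internal_direct_sum R M I N \<longleftrightarrow>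
     (\<forall>i\<in>I. right_submodule R M (N i)) \<and>
     carrier M = submodule_sum M I N \<and>
     (\<forall>i\<in>I. N i \<inter> submodule_sum M (I - {i}) N = {\<zero>\<^bsub>M\<^esub>})"

definition left_ann :: "('r, 'm, 'b) rmodule_scheme \<Rightarrow> 'r set \<Rightarrow> 'm set" where
  "left_ann M A = {m \<in> carrier M. \<forall>x\<in>A. m \<star>\<^bsub>M\<^esub> x = \<zero>\<^bsub>M\<^esub>}"

definition right_ann ::
    "('r, 'a) ring_scheme \<Rightarrow> ('r, 'm, 'b) rmodule_scheme \<Rightarrow> 'm \<Rightarrow> 'r set" where
  "right_ann R M y = {r \<in> carrier R. y \<star>\<^bsub>M\<^esub> r = \<zero>\<^bsub>M\<^esub>}"

text \<open>
  Powers with respect to the ideal product; the zeroth power is the whole ring. The library's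
  power is defined by recursion alone, so it does not depend on the commutativity that the library
  assumes in order to show that \<^const>\<open>ideals_set\<close> is a monoid.
\<close>

abbreviation ideal_power :: "('r, 'a) ring_scheme \<Rightarrow> 'r set \<Rightarrow> nat \<Rightarrow> 'r set" where
  "ideal_power R A k \<equiv> A [^]\<^bsub>ideals_set R\<^esub> k"

definition component ::
    "('r, 'a) ring_scheme \<Rightarrow> ('r, 'm, 'b) rmodule_scheme \<Rightarrow> 'r set \<Rightarrow> 'm set" where
  "component R M A = submodule_sum M {1..} (\<lambda>k. left_ann M (ideal_power R A k))"

definition pairwise_comaximal :: "('r, 'a) ring_scheme \<Rightarrow> 'i set \<Rightarrow> ('i \<Rightarrow> 'r set) \<Rightarrow> bool" where
  "pairwise_comaximal R I A \<longleftrightarrow> pairwise (\<lambda>i j. A i <+>\<^bsub>R\<^esub> A j = carrier R) I"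

text \<open>Intersection of ideals of \<open>R\<close>, with the empty intersection being \<open>R\<close>.\<close>

definition ideal_Inter :: "('r, 'a) ring_scheme \<Rightarrow> 'i set \<Rightarrow> ('i \<Rightarrow> 'r set) \<Rightarrow> 'r set" where
  "ideal_Inter R J A = carrier R \<inter> (\<Inter>j\<in>J. A j)"

end

theory Submission
  imports Defs
begin

text \<open>
  Both parts are instances of one statement about families of descending chains of ideals
  \<open>B i 0 \<supseteq> B i 1 \<supseteq> \<dots>\<close> such that terms of different chains are comaximal: constant chains give (1),
  and the powers of the \<open>X\<^sub>i\<close> give (2). The elements of \<open>M\<close> annihilated by some finite intersection
  of terms of these chains form a submodule, and comaximality identifies it with the sum of the
  submodules \<open>\<Union>k. \<ell>(B i k)\<close>: if \<open>m\<close> is annihilated by \<open>X \<inter> Z\<close> and \<open>1 = x + z\<close> with \<open>x \<in> X\<close> and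
  \<open>z \<in> Z\<close>, then \<open>m = m z + m x\<close>, where \<open>m z\<close> is annihilated by \<open>X\<close> and \<open>m x\<close> by \<open>Z\<close>. The sum is
  always direct, since an element annihilated by both of two comaximal ideals vanishes. Hence the
  direct sum is all of \<open>M\<close> as soon as the submodule contains a generating set.
\<close>

lemma submodule_sum_cong:
  assumes "\<And>i. i \<in> I \<Longrightarrow> N i = N' i"
  shows "submodule_sum M I N = submodule_sum M I N'"
  unfolding submodule_sum_def
  by (intro Collect_cong ex_cong1 conj_cong refl) (use assms in auto)

section \<open>Comaximal ideals\<close>

context ring
begin

text \<open>The sum of two ideals is an ideal, so it is the whole ring as soon as it contains one.
  All later comaximality arguments work with such a decomposition of one.\<close>

lemma comaximal_iff:
  assumes "ideal X R" "ideal Z R"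
  shows "X <+>\<^bsub>R\<^esub> Z = carrier R \<longleftrightarrow> (\<exists>x\<in>X. \<exists>z\<in>Z. x \<oplus> z = \<one>)"
proof
  assume "X <+>\<^bsub>R\<^esub> Z = carrier R"
  then have "\<one> \<in> X <+>\<^bsub>R\<^esub> Z" by simp
  then show "\<exists>x\<in>X. \<exists>z\<in>Z. x \<oplus> z = \<one>" unfolding set_add_def' by force
next
  assume "\<exists>x\<in>X. \<exists>z\<in>Z. x \<oplus> z = \<one>"
  then obtain x z where "x \<in> X" "z \<in> Z" "x \<oplus> z = \<one>" by blast
  moreover from this have "x \<oplus> z \<in> X <+>\<^bsub>R\<^esub> Z" unfolding set_add_def' by blast
  ultimately have "\<one> \<in> X <+>\<^bsub>R\<^esub> Z" by simp
  then show "X <+>\<^bsub>R\<^esub> Z = carrier R"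
    using ideal.one_imp_carrier[OF add_ideals[OF assms]] by blast
qed

text \<open>From \<open>1 = x + z\<close> and \<open>1 = x' + w\<close>, expanding
  \<open>z = z (x' + w)\<close> gives \<open>1 = (x + z x') + z w\<close>, whose bracket lies in
  \<open>X\<close>. The ideal \<open>V\<close> is kept abstract so that the same computation serves
  ideal products and intersections.\<close>

lemma comaximal_multiplicative:
  assumes X: "ideal X R" and Z: "ideal Z R" and W: "ideal W R" and V: "ideal V R"
    and XZ: "X <+>\<^bsub>R\<^esub> Z = carrier R" and XW: "X <+>\<^bsub>R\<^esub> W = carrier R"
    and V_mult: "\<And>z w. \<lbrakk>z \<in> Z; w \<in> W\<rbrakk> \<Longrightarrow> z \<otimes> w \<in> V"
  shows "X <+>\<^bsub>R\<^esub> V = carrier R"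
proof -
  interpret X: ideal X R by fact
  interpret Z: ideal Z R by fact
  interpret W: ideal W R by fact
  obtain x z x' w where x: "x \<in> X" "z \<in> Z" "x \<oplus> z = \<one>" and x': "x' \<in> X" "w \<in> W" "x' \<oplus> w = \<one>"
    using XZ XW comaximal_iff[OF X Z] comaximal_iff[OF X W] by blast
  have c: "x \<in> carrier R" "z \<in> carrier R" "x' \<in> carrier R" "w \<in> carrier R"
    using x x' X.Icarr Z.Icarr W.Icarr by auto
  have "(x \<oplus> z \<otimes> x') \<oplus> z \<otimes> w = x \<oplus> z \<otimes> (x' \<oplus> w)"
    using c by (simp add: r_distr a_assoc)
  also have "\<dots> = \<one>" using x x' c by simp
  finally have "(x \<oplus> z \<otimes> x') \<oplus> z \<otimes> w = \<one>" .
  moreover have "x \<oplus> z \<otimes> x' \<in> X" using x x' c by (simp add: X.I_l_closed X.a_closed)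
  moreover have "z \<otimes> w \<in> V" using x x' V_mult by simp
  ultimately show ?thesis using comaximal_iff[OF X V] by blast
qed

lemma comaximal_carrier:
  assumes "ideal X R"
  shows "X <+>\<^bsub>R\<^esub> carrier R = carrier R"
proof -
  have "\<zero> \<in> X" using assms additive_subgroup.zero_closed ideal.axioms(1) by blast
  moreover have "\<zero> \<oplus> \<one> = \<one>" by simp
  ultimately show ?thesis using comaximal_iff[OF assms oneideal] one_closed by blast
qed

lemma comaximal_commute:
  assumes "ideal X R" "ideal Z R" "X <+>\<^bsub>R\<^esub> Z = carrier R"
  shows "Z <+>\<^bsub>R\<^esub> X = carrier R"
proof -
  have "X \<subseteq> carrier R" "Z \<subseteq> carrier R"
    using ideal.Icarr[OF assms(1)] ideal.Icarr[OF assms(2)] by blast+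
  then have "Z <+>\<^bsub>R\<^esub> X = X <+>\<^bsub>R\<^esub> Z" using set_add_comm by simp
  also note assms(3)
  finally show ?thesis .
qed

section \<open>Powers of an ideal\<close>

lemma ideal_power_0: "ideal_power R X 0 = carrier R"
  by (simp add: ideals_set_def)

lemma ideal_power_Suc: "ideal_power R X (Suc k) = ideal_power R X k \<cdot> X"
  by (simp add: ideals_set_def)

lemma ideal_ideal_power:
  assumes "ideal X R"
  shows "ideal (ideal_power R X k) R"
  by (induction k) (simp_all only: ideal_power_0 ideal_power_Suc oneideal ideal_prod_is_ideal assms)

lemma antimono_ideal_power:
  assumes "ideal X R"
  shows "antimono (ideal_power R X)"
proof (rule antimonoI)
  have "ideal_power R X (Suc k) \<subseteq> ideal_power R X k" for k
    unfolding ideal_power_Suc using ideal_prod_inter[OF ideal_ideal_power[OF assms] assms] by blast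
  then show "ideal_power R X l \<subseteq> ideal_power R X k" if "k \<le> l" for k l
    using that by (rule lift_Suc_antimono_le)
qed

lemma comaximal_ideal_power_right:
  assumes X: "ideal X R" and Z: "ideal Z R" and XZ: "X <+>\<^bsub>R\<^esub> Z = carrier R"
  shows "X <+>\<^bsub>R\<^esub> ideal_power R Z k = carrier R"
proof (induction k)
  case 0
  show ?case unfolding ideal_power_0 by (rule comaximal_carrier[OF X])
next
  case (Suc k)
  show ?case
    by (rule comaximal_multiplicative[OF X ideal_ideal_power[OF Z] Z ideal_ideal_power[OF Z] Suc XZ])
      (unfold ideal_power_Suc, rule ideal_prod.prod)
qed

text \<open>One side is raised at a time: first \<open>Z\<close>, with \<open>X\<close> fixed; then,
  after exchanging sides, \<open>X\<close>, with the power of \<open>Z\<close> as the fixed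
  ideal.\<close>

lemma comaximal_ideal_powers:
  assumes X: "ideal X R" and Z: "ideal Z R" and XZ: "X <+>\<^bsub>R\<^esub> Z = carrier R"
  shows "ideal_power R X k <+>\<^bsub>R\<^esub> ideal_power R Z l = carrier R"
proof -
  have Zl: "ideal (ideal_power R Z l) R" by (rule ideal_ideal_power[OF Z])
  have "ideal_power R Z l <+>\<^bsub>R\<^esub> X = carrier R"
    by (rule comaximal_commute[OF X Zl comaximal_ideal_power_right[OF X Z XZ]])
  then have "ideal_power R Z l <+>\<^bsub>R\<^esub> ideal_power R X k = carrier R"
    by (rule comaximal_ideal_power_right[OF Zl X])
  then show ?thesis by (rule comaximal_commute[OF Zl ideal_ideal_power[OF X]])
qed

section \<open>Finite intersections of ideals\<close>

lemma ideal_ideal_Inter: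
  assumes "\<And>j. j \<in> J \<Longrightarrow> ideal (D j) R"
  shows "ideal (ideal_Inter R J D) R"
proof -
  \<comment> \<open>Inserting the whole ring makes the family nonempty even for
    \<open>J = {}\<close>, as \<open>i_Intersect\<close> demands.\<close>
  have "ideal (\<Inter>(insert (carrier R) (D ` J))) R"
    by (rule i_Intersect) (use assms oneideal in auto)
  then show ?thesis by (simp add: ideal_Inter_def)
qed

lemma comaximal_ideal_Inter:
  assumes "finite J" and X: "ideal X R" and "\<And>j. j \<in> J \<Longrightarrow> ideal (D j) R"
    and "\<And>j. j \<in> J \<Longrightarrow> X <+>\<^bsub>R\<^esub> D j = carrier R"
  shows "X <+>\<^bsub>R\<^esub> ideal_Inter R J D = carrier R"
  using assms(1,3,4)
proof (induction J)
  case empty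
  show ?case by (simp add: ideal_Inter_def comaximal_carrier[OF X])
next
  case (insert j J)
  have J: "ideal (ideal_Inter R J D) R" and j: "ideal (D j) R"
    and jJ: "ideal (ideal_Inter R (insert j J) D) R"
    using insert.prems by (auto intro: ideal_ideal_Inter)
  show ?case
  proof (rule comaximal_multiplicative[OF X j J jJ])
    show "X <+>\<^bsub>R\<^esub> D j = carrier R" "X <+>\<^bsub>R\<^esub> ideal_Inter R J D = carrier R"
      using insert by auto
    \<comment> \<open>A product of elements of two ideals lies in both, so the enlarged intersection
      can take the place of \<open>V\<close>.\<close>
    fix z w assume "z \<in> D j" "w \<in> ideal_Inter R J D"
    then have "z \<otimes> w \<in> D j" "z \<otimes> w \<in> ideal_Inter R J D"
      using ideal.I_r_closed[OF j] ideal.I_l_closed[OF J] ideal.Icarr[OF j] ideal.Icarr[OF J]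
      by auto
    then show "z \<otimes> w \<in> ideal_Inter R (insert j J) D" by (simp add: ideal_Inter_def)
  qed
qed

end

section \<open>Submodules and annihilators\<close>

context right_module
begin

lemma ract_zero_right [simp]:
  assumes "x \<in> carrier M"
  shows "x \<star>\<^bsub>M\<^esub> \<zero>\<^bsub>R\<^esub> = \<zero>\<^bsub>M\<^esub>"
  using ract_distr_scalar[OF assms R.zero_closed R.zero_closed] assms
  by (metis M.add.r_cancel_one R.l_zero R.zero_closed ract_closed)

lemma ract_zero_left [simp]:
  assumes "a \<in> carrier R"
  shows "\<zero>\<^bsub>M\<^esub> \<star>\<^bsub>M\<^esub> a = \<zero>\<^bsub>M\<^esub>"
  using ract_distr_add[OF M.zero_closed M.zero_closed assms] assms
  by (metis M.add.r_cancel_one M.l_zero M.zero_closed ract_closed)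

lemma ract_minus_one:
  assumes "x \<in> carrier M"
  shows "x \<star>\<^bsub>M\<^esub> (\<ominus>\<^bsub>R\<^esub> \<one>\<^bsub>R\<^esub>) = \<ominus>\<^bsub>M\<^esub> x"
proof -
  have "x \<star>\<^bsub>M\<^esub> (\<ominus>\<^bsub>R\<^esub> \<one>\<^bsub>R\<^esub>) \<oplus>\<^bsub>M\<^esub> x = x \<star>\<^bsub>M\<^esub> (\<ominus>\<^bsub>R\<^esub> \<one>\<^bsub>R\<^esub> \<oplus>\<^bsub>R\<^esub> \<one>\<^bsub>R\<^esub>)"
    using assms by (simp only: ract_distr_scalar R.a_inv_closed R.one_closed ract_one)
  also have "\<dots> = \<zero>\<^bsub>M\<^esub>" using assms by (simp add: R.l_neg)
  finally show ?thesis using assms by (metis M.minus_equality R.a_inv_closed R.one_closed ract_closed)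
qed

text \<open>Closure under negation comes from the action of \<open>-1\<close>, by
  \<open>ract_minus_one\<close>.\<close>

lemma right_submoduleI:
  assumes "N \<subseteq> carrier M" "\<zero>\<^bsub>M\<^esub> \<in> N"
    and "\<And>x y. \<lbrakk>x \<in> N; y \<in> N\<rbrakk> \<Longrightarrow> x \<oplus>\<^bsub>M\<^esub> y \<in> N"
    and "\<And>x a. \<lbrakk>x \<in> N; a \<in> carrier R\<rbrakk> \<Longrightarrow> x \<star>\<^bsub>M\<^esub> a \<in> N"
  shows "right_submodule R M N"
proof -
  have "subgroup N (add_monoid M)"
  proof (rule M.add.subgroupI)
    show "\<ominus>\<^bsub>M\<^esub> x \<in> N" if "x \<in> N" for x
      using assms(1) assms(4)[OF that, of "\<ominus>\<^bsub>R\<^esub> \<one>\<^bsub>R\<^esub>"] that ract_minus_one[of x] by auto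
  qed (use assms in auto)
  then show ?thesis using assms(4) by (simp add: right_submodule_def)
qed

lemma right_submodule_closed:
  assumes "right_submodule R M N"
  shows "N \<subseteq> carrier M" "\<zero>\<^bsub>M\<^esub> \<in> N" "\<lbrakk>x \<in> N; y \<in> N\<rbrakk> \<Longrightarrow> x \<oplus>\<^bsub>M\<^esub> y \<in> N"
  using assms subgroup.subset subgroup.one_closed subgroup.m_closed
  unfolding right_submodule_def by fastforce+

lemma right_submodule_finsum:
  assumes N: "right_submodule R M N" and "finite F" "\<And>i. i \<in> F \<Longrightarrow> f i \<in> N"
  shows "finsum M f F \<in> N"
  using assms(2,3)
proof (induction F)
  case empty
  show ?case by (simp add: right_submodule_closed(2)[OF N])
next
  case (insert i F)
  then have "finsum M f (insert i F) = f i \<oplus>\<^bsub>M\<^esub> finsum M f F"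
    using right_submodule_closed(1)[OF N] by (intro M.finsum_insert) auto
  then show ?case using insert right_submodule_closed(3)[OF N] by simp
qed

lemma left_ann_antimono: "X \<subseteq> Z \<Longrightarrow> left_ann M Z \<subseteq> left_ann M X"
  by (auto simp: left_ann_def)

text \<open>Stability under the action rests on left absorption: \<open>(m a) x = m (a x)\<close>
  with \<open>a x\<close> in \<open>X\<close>.\<close>

lemma right_submodule_left_ann:
  assumes "ideal X R"
  shows "right_submodule R M (left_ann M X)"
proof -
  interpret X: ideal X R by fact
  show ?thesis
    by (rule right_submoduleI)
      (auto simp: left_ann_def X.Icarr ract_distr_add X.I_l_closed simp flip: ract_assoc)
qed

lemma left_ann_comaximal:
  assumes "ideal X R" "ideal Z R" "X <+>\<^bsub>R\<^esub> Z = carrier R"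
    and "m \<in> left_ann M X" "m \<in> left_ann M Z"
  shows "m = \<zero>\<^bsub>M\<^esub>"
proof -
  obtain x z where xz: "x \<in> X" "z \<in> Z" "x \<oplus>\<^bsub>R\<^esub> z = \<one>\<^bsub>R\<^esub>"
    using assms R.comaximal_iff by blast
  then have "m \<star>\<^bsub>M\<^esub> \<one>\<^bsub>R\<^esub> = m \<star>\<^bsub>M\<^esub> x \<oplus>\<^bsub>M\<^esub> m \<star>\<^bsub>M\<^esub> z"
    using assms by (metis (mono_tags, lifting) ideal.Icarr left_ann_def mem_Collect_eq ract_distr_scalar)
  then show ?thesis using assms(4,5) xz by (simp add: left_ann_def)
qed

text \<open>Each summand is annihilated by the smaller ideal \<open>ideal_Inter R J D\<close>, whose
  annihilator is a submodule. Under comaximality, \<open>left_ann_ideal_Inter_decomp\<close>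
  supplies the converse.\<close>

lemma finsum_in_left_ann_ideal_Inter:
  assumes D: "\<And>j. j \<in> J \<Longrightarrow> ideal (D j) R"
    and "finite J" and f: "\<And>j. j \<in> J \<Longrightarrow> f j \<in> left_ann M (D j)"
  shows "finsum M f J \<in> left_ann M (ideal_Inter R J D)"
proof (rule right_submodule_finsum[OF right_submodule_left_ann \<open>finite J\<close>])
  show "ideal (ideal_Inter R J D) R" using D by (rule R.ideal_ideal_Inter)
  show "f j \<in> left_ann M (ideal_Inter R J D)" if "j \<in> J" for j
    using f[OF that] left_ann_antimono[of "ideal_Inter R J D" "D j"] that
    by (auto simp: ideal_Inter_def)
qed

text \<open>Induction on \<open>J\<close>: the new ideal \<open>D i\<close> is comaximal with the
  intersection of the others. Splitting one accordingly, \<open>m z\<close> becomes the summand at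
  \<open>i\<close>, and the induction hypothesis decomposes \<open>m x\<close>.\<close>

lemma left_ann_ideal_Inter_decomp:
  assumes "finite J" and "pairwise_comaximal R J D" and "\<And>j. j \<in> J \<Longrightarrow> ideal (D j) R"
    and "m \<in> left_ann M (ideal_Inter R J D)"
  shows "\<exists>f. (\<forall>j\<in>J. f j \<in> left_ann M (D j)) \<and> m = finsum M f J"
  using assms
proof (induction J arbitrary: m)
  \<comment> \<open>The empty intersection is the whole ring and contains one, so
    \<open>m = m 1 = 0\<close> is the empty sum.\<close>
  case empty
  then have "m \<in> carrier M" "m \<star>\<^bsub>M\<^esub> \<one>\<^bsub>R\<^esub> = \<zero>\<^bsub>M\<^esub>"
    by (simp_all del: ract_one add: left_ann_def ideal_Inter_def)
  then have "m = \<zero>\<^bsub>M\<^esub>" by simp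
  then show ?case by simp
next
  case (insert i J)
  let ?Z = "ideal_Inter R J D"
  have i: "ideal (D i) R" and Z: "ideal ?Z R"
    using insert.prems by (auto intro: R.ideal_ideal_Inter)
  interpret i: ideal "D i" R by fact
  interpret Z: ideal ?Z R by fact
  have "D i <+>\<^bsub>R\<^esub> ?Z = carrier R"
    by (rule R.comaximal_ideal_Inter[OF insert.hyps(1) i])
      (use insert in \<open>auto simp: pairwise_comaximal_def pairwise_insert\<close>)
  then obtain x z where xz: "x \<in> D i" "z \<in> ?Z" "x \<oplus>\<^bsub>R\<^esub> z = \<one>\<^bsub>R\<^esub>"
    using R.comaximal_iff[OF i Z] by blast
  have c: "m \<in> carrier M" "x \<in> carrier R" "z \<in> carrier R"
    using insert.prems(3) xz i.Icarr Z.Icarr by (auto simp: left_ann_def)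
  have kill: "m \<star>\<^bsub>M\<^esub> r = \<zero>\<^bsub>M\<^esub>" if "r \<in> D i" "r \<in> ?Z" for r
    using insert.prems(3) that by (auto simp: left_ann_def ideal_Inter_def)
  \<comment> \<open>For \<open>r\<close> in \<open>D i\<close>, the product \<open>z r\<close> lies
    in \<open>D i\<close> by left absorption and in \<open>?Z\<close> by right absorption, so
    \<open>m\<close> kills it. The claim for \<open>m x\<close> is symmetric.\<close>
  have mz: "m \<star>\<^bsub>M\<^esub> z \<in> left_ann M (D i)"
    using c xz by (auto simp: left_ann_def i.Icarr i.I_l_closed Z.I_r_closed kill simp flip: ract_assoc)
  have "m \<star>\<^bsub>M\<^esub> x \<in> left_ann M ?Z"
    using c xz by (auto simp: left_ann_def Z.Icarr Z.I_l_closed i.I_r_closed kill simp flip: ract_assoc)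
  moreover have "pairwise_comaximal R J D"
    using insert.prems(1) by (simp add: pairwise_comaximal_def pairwise_insert)
  ultimately obtain f where f: "\<And>j. j \<in> J \<Longrightarrow> f j \<in> left_ann M (D j)" "m \<star>\<^bsub>M\<^esub> x = finsum M f J"
    using insert.IH[of "m \<star>\<^bsub>M\<^esub> x"] insert.prems(2) by blast
  let ?g = "f(i := m \<star>\<^bsub>M\<^esub> z)"
  have g: "\<forall>j\<in>insert i J. ?g j \<in> left_ann M (D j)"
    using f mz by auto
  have "finsum M ?g (insert i J) = ?g i \<oplus>\<^bsub>M\<^esub> finsum M ?g J"
    using insert.hyps g by (intro M.finsum_insert) (auto simp: left_ann_def)
  also have "finsum M ?g J = finsum M f J"
    using insert.hyps f by (intro M.finsum_cong') (auto simp: left_ann_def)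
  also have "?g i \<oplus>\<^bsub>M\<^esub> finsum M f J = m \<star>\<^bsub>M\<^esub> (x \<oplus>\<^bsub>R\<^esub> z)"
    using c by (simp add: ract_distr_scalar M.a_comm flip: f(2))
  also have "\<dots> = m" using xz c by simp
  finally show ?case using g by metis
qed

text \<open>The annihilators of a descending chain increase, so two elements of the union already
  lie together at the level \<open>max k l\<close>.\<close>

lemma right_submodule_UN_chain:
  fixes X :: "nat \<Rightarrow> 'r set"
  assumes X: "\<And>k. ideal (X k) R" and "antimono X"
  shows "right_submodule R M (\<Union>k. left_ann M (X k))"
proof (rule right_submoduleI)
  have mono: "left_ann M (X k) \<subseteq> left_ann M (X (max k l))"
    "left_ann M (X l) \<subseteq> left_ann M (X (max k l))" for k l
    using antimonoD[OF assms(2)] by (simp_all add: left_ann_antimono)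
  note closed = right_submodule_closed[OF right_submodule_left_ann[OF X]]
  show "(\<Union>k. left_ann M (X k)) \<subseteq> carrier M" "\<zero>\<^bsub>M\<^esub> \<in> (\<Union>k. left_ann M (X k))"
    using closed(1,2) by blast+
  show "x \<oplus>\<^bsub>M\<^esub> y \<in> (\<Union>k. left_ann M (X k))"
    if "x \<in> (\<Union>k. left_ann M (X k))" "y \<in> (\<Union>k. left_ann M (X k))" for x y
  proof -
    obtain k l where "x \<in> left_ann M (X k)" "y \<in> left_ann M (X l)" using \<open>x \<in> _\<close> \<open>y \<in> _\<close> by blast
    then have "x \<oplus>\<^bsub>M\<^esub> y \<in> left_ann M (X (max k l))" using mono closed(3) by blast
    then show ?thesis by blast
  qed
  show "x \<star>\<^bsub>M\<^esub> a \<in> (\<Union>k. left_ann M (X k))"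
    if "x \<in> (\<Union>k. left_ann M (X k))" "a \<in> carrier R" for x a
    using that right_submodule_left_ann[OF X] unfolding right_submodule_def by blast
qed

text \<open>The annihilators of the powers form an increasing chain of submodules, and the sum of
  such a chain is its union.\<close>

lemma component_eq_UN:
  assumes X: "ideal X R"
  shows "component R M X = (\<Union>k. left_ann M (ideal_power R X k))" (is "_ = ?U")
proof
  have U: "right_submodule R M ?U"
    by (intro right_submodule_UN_chain R.ideal_ideal_power R.antimono_ideal_power X)
  show "component R M X \<subseteq> ?U"
    by (auto simp: component_def submodule_sum_def intro!: right_submodule_finsum[OF U])
  show "?U \<subseteq> component R M X"
  proof
    fix m assume "m \<in> ?U"
    then obtain k where "m \<in> left_ann M (ideal_power R X k)" by blast
    \<comment> \<open>The union starts at exponent 0 but the sum at 1; passing to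
      \<open>Suc k\<close> brings every exponent into the range of the sum.\<close>
    then have m: "m \<in> left_ann M (ideal_power R X (Suc k))"
      using left_ann_antimono[OF antimonoD[OF R.antimono_ideal_power[OF X], of k "Suc k"]] by auto
    then have "m = finsum M (\<lambda>_. m) {Suc k}"
      by (simp add: left_ann_def)
    then show "m \<in> component R M X"
      unfolding component_def submodule_sum_def using m
      by (intro CollectI exI[of _ "\<lambda>_. m"] exI[of _ "{Suc k}"]) auto
  qed
qed

end

section \<open>Families of chains with comaximal terms\<close>

locale comaximal_chains = right_module R M
  for R :: "('r, 'a) ring_scheme" (structure)
    and M :: "('r, 'm, 'b) rmodule_scheme" (structure) +
  fixes I :: "'i set" and B :: "'i \<Rightarrow> nat \<Rightarrow> 'r set"
  assumes ideal_B: "i \<in> I \<Longrightarrow> ideal (B i k) R"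
    and antimono_B: "i \<in> I \<Longrightarrow> antimono (B i)"
    and comaximal_B: "\<lbrakk>i \<in> I; j \<in> I; i \<noteq> j\<rbrakk> \<Longrightarrow> B i k <+>\<^bsub>R\<^esub> B j l = carrier R"
begin

text \<open>Phrased through \<open>left_ann\<close>, so that closure properties of submodules apply;
  \<open>locally_annihilated_iff\<close> returns to \<open>right_ann\<close>.\<close>

definition locally_annihilated :: "'m \<Rightarrow> bool" where
  "locally_annihilated m \<longleftrightarrow>
     (\<exists>J k. finite J \<and> J \<subseteq> I \<and> m \<in> left_ann M (ideal_Inter R J (\<lambda>j. B j (k j))))"

lemma locally_annihilated_iff:
  assumes "m \<in> carrier M"
  shows "locally_annihilated m \<longleftrightarrow>
    (\<exists>J k. finite J \<and> J \<subseteq> I \<and> ideal_Inter R J (\<lambda>j. B j (k j)) \<subseteq> right_ann R M m)"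
proof -
  have "m \<in> left_ann M (ideal_Inter R J D) \<longleftrightarrow> ideal_Inter R J D \<subseteq> right_ann R M m"
    for J :: "'i set" and D
    using assms by (auto simp: left_ann_def right_ann_def ideal_Inter_def)
  then show ?thesis by (simp add: locally_annihilated_def)
qed

lemma ideal_Inter_B:
  assumes "J \<subseteq> I"
  shows "ideal (ideal_Inter R J (\<lambda>j. B j (k j))) R"
  using assms ideal_B by (intro R.ideal_ideal_Inter) auto

lemma right_submodule_locally_annihilated: "right_submodule R M {m. locally_annihilated m}"
proof (rule right_submoduleI)
  show "{m. locally_annihilated m} \<subseteq> carrier M"
    by (auto simp: locally_annihilated_def left_ann_def)
  \<comment> \<open>Zero is annihilated by the whole ring, the intersection over
    \<open>J = {}\<close>; the level 0 is arbitrary.\<close>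
  have "\<zero>\<^bsub>M\<^esub> \<in> left_ann M (ideal_Inter R {} (\<lambda>j. B j 0))"
    by (simp add: left_ann_def ideal_Inter_def)
  then show "\<zero>\<^bsub>M\<^esub> \<in> {m. locally_annihilated m}"
    unfolding locally_annihilated_def
    by (intro CollectI exI[of _ "{}"] exI[of _ "\<lambda>_. 0"]) auto
next
  fix x y assume "x \<in> {m. locally_annihilated m}" "y \<in> {m. locally_annihilated m}"
  then obtain J k J' k' where J: "finite J" "J \<subseteq> I" "finite J'" "J' \<subseteq> I"
    and x: "x \<in> left_ann M (ideal_Inter R J (\<lambda>j. B j (k j)))"
    and y: "y \<in> left_ann M (ideal_Inter R J' (\<lambda>j. B j (k' j)))"
    by (auto simp: locally_annihilated_def)
  \<comment> \<open>A common ideal for \<open>x\<close> and \<open>y\<close>: uniting the index sets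
    and taking the larger level at each index can only shrink either intersection.\<close>
  let ?Z = "ideal_Inter R (J \<union> J') (\<lambda>j. B j (max (k j) (k' j)))"
  have "B j (max (k j) (k' j)) \<subseteq> B j (k j) \<inter> B j (k' j)" if "j \<in> I" for j
    using antimono_B[OF that] by (auto simp: antimono_def)
  then have "?Z \<subseteq> ideal_Inter R J (\<lambda>j. B j (k j))" "?Z \<subseteq> ideal_Inter R J' (\<lambda>j. B j (k' j))"
    using J unfolding ideal_Inter_def by blast+
  then have "x \<in> left_ann M ?Z" "y \<in> left_ann M ?Z"
    using x y left_ann_antimono by blast+
  then have "x \<oplus>\<^bsub>M\<^esub> y \<in> left_ann M ?Z"
    using right_submodule_closed(3) right_submodule_left_ann ideal_Inter_B J by (metis Un_least)
  then show "x \<oplus>\<^bsub>M\<^esub> y \<in> {m. locally_annihilated m}"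
    using J unfolding locally_annihilated_def
    by (intro CollectI exI[of _ "J \<union> J'"] exI[of _ "\<lambda>j. max (k j) (k' j)"]) auto
next
  fix x a assume "x \<in> {m. locally_annihilated m}" "a \<in> carrier R"
  then show "x \<star>\<^bsub>M\<^esub> a \<in> {m. locally_annihilated m}"
    using right_submodule_left_ann[OF ideal_Inter_B]
    unfolding locally_annihilated_def right_submodule_def by blast
qed

text \<open>Stated for every \<open>K \<subseteq> I\<close>: the case \<open>K = I\<close> describes
  the whole sum, and \<open>K = I - {i}\<close> enters the proof of independence.\<close>

lemma submodule_sum_eq_locally_annihilated:
  assumes "K \<subseteq> I"
  shows "submodule_sum M K (\<lambda>i. \<Union>k. left_ann M (B i k)) =
    {m. \<exists>J k. finite J \<and> J \<subseteq> K \<and> m \<in> left_ann M (ideal_Inter R J (\<lambda>j. B j (k j)))}"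
    (is "?S = ?T")
proof
  show "?S \<subseteq> ?T"
  proof
    fix m assume "m \<in> ?S"
    then obtain f F where F: "finite F" "F \<subseteq> K" "m = finsum M f F"
      and "\<forall>i\<in>F. \<exists>k. f i \<in> left_ann M (B i k)"
      by (auto simp: submodule_sum_def)
    then obtain k where "\<And>i. i \<in> F \<Longrightarrow> f i \<in> left_ann M (B i (k i))" by metis
    then have "m \<in> left_ann M (ideal_Inter R F (\<lambda>j. B j (k j)))"
      unfolding F(3) using F assms ideal_B by (intro finsum_in_left_ann_ideal_Inter) auto
    then show "m \<in> ?T" using F by blast
  qed
  show "?T \<subseteq> ?S"
  proof
    fix m assume "m \<in> ?T"
    then obtain J k where J: "finite J" "J \<subseteq> K"
      and m: "m \<in> left_ann M (ideal_Inter R J (\<lambda>j. B j (k j)))" by blast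
    \<comment> \<open>The levels \<open>k j\<close> vary with \<open>j\<close>, which is why
      \<open>comaximal_B\<close> covers all pairs of levels.\<close>
    have "pairwise_comaximal R J (\<lambda>j. B j (k j))"
      unfolding pairwise_comaximal_def
      by (rule pairwiseI, rule comaximal_B) (use J assms in auto)
    then obtain f where "\<forall>j\<in>J. f j \<in> left_ann M (B j (k j))" "m = finsum M f J"
      using left_ann_ideal_Inter_decomp[OF J(1) _ _ m] J assms ideal_B by (metis subsetD)
    then show "m \<in> ?S" using J by (auto simp: submodule_sum_def)
  qed
qed

text \<open>An element of the sum over \<open>I - {i}\<close> is annihilated by a finite
  intersection of chain terms with indices other than \<open>i\<close>. That intersection is
  comaximal with each \<open>B i l\<close>, so \<open>left_ann_comaximal\<close> applies.\<close>

lemma components_independent: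
  assumes i: "i \<in> I"
  shows "(\<Union>k. left_ann M (B i k)) \<inter> submodule_sum M (I - {i}) (\<lambda>i. \<Union>k. left_ann M (B i k))
    = {\<zero>\<^bsub>M\<^esub>}" (is "?C \<inter> ?S = _")
proof
  show "?C \<inter> ?S \<subseteq> {\<zero>\<^bsub>M\<^esub>}"
  proof
    fix m assume "m \<in> ?C \<inter> ?S"
    then obtain l J k where l: "m \<in> left_ann M (B i l)" and J: "finite J" "J \<subseteq> I - {i}"
      and m: "m \<in> left_ann M (ideal_Inter R J (\<lambda>j. B j (k j)))"
      by (auto simp: submodule_sum_eq_locally_annihilated)
    have "B i l <+>\<^bsub>R\<^esub> ideal_Inter R J (\<lambda>j. B j (k j)) = carrier R"
      by (rule R.comaximal_ideal_Inter[OF J(1)]; (rule comaximal_B ideal_B)?) (use i J in auto)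
    then show "m \<in> {\<zero>\<^bsub>M\<^esub>}"
      using left_ann_comaximal l m i J ideal_B ideal_Inter_B by (metis Diff_subset singletonI subset_trans)
  qed
  have "\<zero>\<^bsub>M\<^esub> = finsum M (\<lambda>_. \<zero>\<^bsub>M\<^esub>) {}" by simp
  then have "\<zero>\<^bsub>M\<^esub> \<in> ?S"
    unfolding submodule_sum_def
    by (intro CollectI exI[of _ "\<lambda>_. \<zero>\<^bsub>M\<^esub>"] exI[of _ "{}"]) auto
  moreover have "\<zero>\<^bsub>M\<^esub> \<in> ?C"
    using right_submodule_closed(2) right_submodule_left_ann ideal_B i by blast
  ultimately show "{\<zero>\<^bsub>M\<^esub>} \<subseteq> ?C \<inter> ?S" by blast
qed

theorem internal_direct_sum_iff:
  assumes Y: "generates R M Y"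
  shows "(\<forall>y\<in>Y. \<exists>J k. finite J \<and> J \<subseteq> I \<and> ideal_Inter R J (\<lambda>j. B j (k j)) \<subseteq> right_ann R M y)
    \<longleftrightarrow> internal_direct_sum R M I (\<lambda>i. \<Union>k. left_ann M (B i k))"
proof -
  let ?T = "{m. locally_annihilated m}"
  note T = right_submodule_locally_annihilated
  have "(\<forall>y\<in>Y. \<exists>J k. finite J \<and> J \<subseteq> I \<and> ideal_Inter R J (\<lambda>j. B j (k j)) \<subseteq> right_ann R M y)
    \<longleftrightarrow> Y \<subseteq> ?T"
    using Y locally_annihilated_iff by (auto simp: generates_def subset_iff)
  \<comment> \<open>Since \<open>?T\<close> is a submodule, containing the generators forces it to
    be all of \<open>M\<close>.\<close>
  also have "\<dots> \<longleftrightarrow> carrier M = ?T"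
  proof
    assume "Y \<subseteq> ?T"
    with T have "\<Inter>{N. right_submodule R M N \<and> Y \<subseteq> N} \<subseteq> ?T" by blast
    then show "carrier M = ?T"
      using Y right_submodule_closed(1)[OF T] by (simp add: generates_def)
  qed (use Y in \<open>simp add: generates_def\<close>)
  also have "?T = submodule_sum M I (\<lambda>i. \<Union>k. left_ann M (B i k))"
    by (simp add: submodule_sum_eq_locally_annihilated locally_annihilated_def)
  \<comment> \<open>Independence holds automatically, so the sum being all of \<open>M\<close> is
    the only remaining condition.\<close>
  also have "carrier M = \<dots> \<longleftrightarrow> internal_direct_sum R M I (\<lambda>i. \<Union>k. left_ann M (B i k))"
  proof -
    have "right_submodule R M (\<Union>k. left_ann M (B i k))" if "i \<in> I" for i
      using that ideal_B antimono_B by (intro right_submodule_UN_chain)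
    then show ?thesis
      using components_independent unfolding internal_direct_sum_def by blast
  qed
  finally show ?thesis .
qed

end

section \<open>Constant chains and chains of powers\<close>

theorem theorem2p3:
  fixes R :: "('r, 'a) ring_scheme"
    and M :: "('r, 'm, 'b) rmodule_scheme"
    and I :: "'i set"
    and A :: "'i \<Rightarrow> 'r set"
    and Y :: "'m set"
  assumes "right_module R M"
    and "I \<noteq> {}"
    and "\<And>i. i \<in> I \<Longrightarrow> ideal (A i) R"
    and "pairwise_comaximal R I A"
    and "generates R M Y"
  shows "((\<forall>y\<in>Y. \<exists>J. finite J \<and> J \<subseteq> I \<and> ideal_Inter R J A \<subseteq> right_ann R M y)
            \<longleftrightarrow> internal_direct_sum R M I (\<lambda>i. left_ann M (A i)))
       \<and> ((\<forall>y\<in>Y. \<exists>J k. finite J \<and> J \<subseteq> I \<and> (\<forall>j\<in>J. 0 < k j) \<and>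
              ideal_Inter R J (\<lambda>j. ideal_power R (A j) (k j)) \<subseteq> right_ann R M y)
            \<longleftrightarrow> internal_direct_sum R M I (\<lambda>i. component R M (A i)))"
proof (intro conjI)
  interpret right_module R M by fact
  have comaximal: "A i <+>\<^bsub>R\<^esub> A j = carrier R" if "i \<in> I" "j \<in> I" "i \<noteq> j" for i j
    using assms(4) that by (auto simp: pairwise_comaximal_def pairwise_def)
  \<comment> \<open>For constant chains the choice of levels is immaterial and the union over
    \<open>k\<close> collapses to \<open>left_ann M (A i)\<close>.\<close>
  interpret const: comaximal_chains R M I "\<lambda>i _. A i"
    by (intro comaximal_chains.intro comaximal_chains_axioms.intro assms(1,3) comaximal antimonoI
        order_refl)
  show "(\<forall>y\<in>Y. \<exists>J. finite J \<and> J \<subseteq> I \<and> ideal_Inter R J A \<subseteq> right_ann R M y)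
      \<longleftrightarrow> internal_direct_sum R M I (\<lambda>i. left_ann M (A i))"
    using const.internal_direct_sum_iff[OF assms(5)] by simp
  interpret powers: comaximal_chains R M I "\<lambda>i. ideal_power R (A i)"
    by (intro comaximal_chains.intro comaximal_chains_axioms.intro assms(1,3) comaximal
        R.ideal_ideal_power R.antimono_ideal_power R.comaximal_ideal_powers)
  \<comment> \<open>Chains of powers include the exponent 0, whereas the theorem asks for positive
    exponents. Replacing \<open>k j\<close> by \<open>Suc (k j)\<close> shrinks the intersection, so
    the two conditions agree.\<close>
  have positive: "(\<exists>J k. finite J \<and> J \<subseteq> I \<and> (\<forall>j\<in>J. 0 < k j) \<and>
        ideal_Inter R J (\<lambda>j. ideal_power R (A j) (k j)) \<subseteq> right_ann R M y)
    \<longleftrightarrow> (\<exists>J k. finite J \<and> J \<subseteq> I \<and>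
        ideal_Inter R J (\<lambda>j. ideal_power R (A j) (k j)) \<subseteq> right_ann R M y)" (is "?L \<longleftrightarrow> ?R") for y
  proof
    assume ?R
    then obtain J k where J: "finite J" "J \<subseteq> I"
      and y: "ideal_Inter R J (\<lambda>j. ideal_power R (A j) (k j)) \<subseteq> right_ann R M y" by blast
    have "ideal_power R (A j) (Suc (k j)) \<subseteq> ideal_power R (A j) (k j)" if "j \<in> J" for j
      using J(2) that by (intro antimonoD[OF powers.antimono_B]) auto
    then have "ideal_Inter R J (\<lambda>j. ideal_power R (A j) (Suc (k j)))
        \<subseteq> ideal_Inter R J (\<lambda>j. ideal_power R (A j) (k j))"
      unfolding ideal_Inter_def by (intro Int_mono INT_anti_mono order_refl)
    with y have "ideal_Inter R J (\<lambda>j. ideal_power R (A j) (Suc (k j))) \<subseteq> right_ann R M y"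
      by (rule order_trans[rotated])
    then show ?L using J by (intro exI[of _ J] exI[of _ "\<lambda>j. Suc (k j)"]) (simp del: nat_pow_Suc)
  qed blast
  have "internal_direct_sum R M I (\<lambda>i. component R M (A i))
    \<longleftrightarrow> internal_direct_sum R M I (\<lambda>i. \<Union>k. left_ann M (ideal_power R (A i) k))"
  proof -
    \<comment> \<open>Components are rewritten only at indices in \<open>I\<close>, where
      \<open>A i\<close> is known to be an ideal; the sums over \<open>I\<close> and over
      \<open>I - {i}\<close> are both instances.\<close>
    have "submodule_sum M K (\<lambda>i. component R M (A i))
      = submodule_sum M K (\<lambda>i. \<Union>k. left_ann M (ideal_power R (A i) k))" if "K \<subseteq> I" for K
      using that component_eq_UN assms(3) by (intro submodule_sum_cong) auto
    then show ?thesis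
      using component_eq_UN assms(3) by (simp add: internal_direct_sum_def)
  qed
  then show "(\<forall>y\<in>Y. \<exists>J k. finite J \<and> J \<subseteq> I \<and> (\<forall>j\<in>J. 0 < k j) \<and>
        ideal_Inter R J (\<lambda>j. ideal_power R (A j) (k j)) \<subseteq> right_ann R M y)
      \<longleftrightarrow> internal_direct_sum R M I (\<lambda>i. component R M (A i))"
    using powers.internal_direct_sum_iff[OF assms(5)] unfolding positive by simp
qed

end
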